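(* Let $r,d$ be positive integers and let $s\geq (r-1)(d+1)+2$. Suppose that there exist $a_0, n_0$ such that for all $a\geq a_0$ and $n\geq n_0$ we have \[\mathrm{ex}_{\Pi}(n, s, \Sigma_{r,d}(a,s)) = \Pi_{r,d}(a,n).\] Then there exist $a_1\geq a_0$ and $n_1\geq n_0$ such that for all $a\geq a_1$ and $n\geq n_1$, we have \[\mathrm{ex}_{\Pi}(n, s+1, \Sigma_{r,d}(a,s+1)) = \Pi_{r,d}(a,n).\]
   Context: A multigraph is a pair $G=(V,w)$ where $V$ is a finite set and $w:\binom{V}{2}\to\mathbb{Z}_{\geq 0}$. For $X\subseteq V$ write $e(G[X])=\sum_{xy\in\binom{X}{2}}w(xy)$, $e(G)=e(G[V])$ and $P(G)=\prod_{xy\in\binom{V}{2}}w(xy)$. Given integers $s\geq 2$, $q\geq 0$, $\mathcal{F}(n,s,q)$ denotes the set of multigraphs on vertex set $[n]=\{1,\dots,n\}$ in which every $s$-set $X$ of vertices satisfies $e(G[X])\leq q$, and $\mathrm{ex}_{\Pi}(n,s,q)=\max\{P(G): G\in\mathcal{F}(n,s,q)\}$. For positive integers $a,r$, $d\in\{0,\dots,a-1\}$ and $n$, $\mathcal{T}_{r,d}(a,n)$ is the set of multigraphs $G$ on $[n]$ whose vertex set can be partitioned into $r$ parts $V_0,\dots,V_{r-1}$ such that all pairs inside $V_0$ have multiplicity $a-d$, all pairs inside $V_i$ ($1\le i\le r-1$) have multiplicity $a$, and all other pairs have multiplicity $a+1$. $\Sigma_{r,d}(a,n)=\max\{e(G):G\in\mathcal{T}_{r,d}(a,n)\}$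 and $\Pi_{r,d}(a,n)=\max\{P(G):G\in\mathcal{T}_{r,d}(a,n)\}$. *)

theory Defs
  imports "HOL-Library.Ramsey" "HOL-Library.Disjoint_Sets" "HOL-Library.FuncSet"
begin

text \<open>The set of unordered pairs of a set \<open>V\<close> is the library's \<open>[V]\<^bsup>2\<^esup>\<close> (constant \<open>nsets\<close>).\<close>

type_synonym 'a multigraph = "'a set \<times> ('a set \<Rightarrow> nat)"

abbreviation (input) verts :: "'a multigraph \<Rightarrow> 'a set" where "verts \<equiv> fst"

abbreviation (input) mult :: "'a multigraph \<Rightarrow> 'a set \<Rightarrow> nat" where "mult \<equiv> snd"

text \<open>The multiplicity function is extensional, so a multigraph is determined by its values on
  the pairs of vertices.\<close>

definition multigraph :: "'a multigraph \<Rightarrow> bool" where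
  "multigraph G \<longleftrightarrow> finite (verts G) \<and> mult G \<in> [verts G]\<^bsup>2\<^esup> \<rightarrow>\<^sub>E UNIV"

definition edges_in :: "'a multigraph \<Rightarrow> 'a set \<Rightarrow> nat" where
  "edges_in G X = (\<Sum>e\<in>[X]\<^bsup>2\<^esup>. mult G e)"

definition edges :: "'a multigraph \<Rightarrow> nat" where
  "edges G = edges_in G (verts G)"

definition edge_product :: "'a multigraph \<Rightarrow> nat" where
  "edge_product G = (\<Prod>e\<in>[verts G]\<^bsup>2\<^esup>. mult G e)"

definition sq_graphs :: "nat \<Rightarrow> nat \<Rightarrow> nat \<Rightarrow> nat multigraph set" where
  "sq_graphs n s q =
     {G. multigraph G \<and> verts G = {1..n} \<and> (\<forall>X\<in>[verts G]\<^bsup>s\<^esup>. edges_in G X \<le> q)}"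

text \<open>For \<open>2 \<le> s \<le> n\<close> the set \<open>sq_graphs n s q\<close> is finite and nonempty, so the maximum exists.
  For \<open>n < s\<close> the condition on \<open>s\<close>-sets is vacuous, and there is in general no maximum.\<close>

definition ex_prod :: "nat \<Rightarrow> nat \<Rightarrow> nat \<Rightarrow> nat" where
  "ex_prod n s q = Max (edge_product ` sq_graphs n s q)"

text \<open>The family below is only of interest for \<open>d < a\<close>; otherwise \<open>a - d\<close> is truncated to \<open>0\<close>.
  Parts may be empty.\<close>

definition turan_graphs :: "nat \<Rightarrow> nat \<Rightarrow> nat \<Rightarrow> nat \<Rightarrow> nat multigraph set" where
  "turan_graphs r d a n =
     {G. multigraph G \<and> verts G = {1..n} \<and>
         (\<exists>V :: nat \<Rightarrow> nat set.
            disjoint_family_on V {..<r} \<and> (\<Union>i<r. V i) = verts G \<and>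
            (\<forall>e\<in>[V 0]\<^bsup>2\<^esup>. mult G e = a - d) \<and>
            (\<forall>i\<in>{1..<r}. \<forall>e\<in>[V i]\<^bsup>2\<^esup>. mult G e = a) \<and>
            (\<forall>e\<in>[verts G]\<^bsup>2\<^esup>. (\<forall>i<r. e \<notin> [V i]\<^bsup>2\<^esup>) \<longrightarrow> mult G e = a + 1))}"

definition turan_sum :: "nat \<Rightarrow> nat \<Rightarrow> nat \<Rightarrow> nat \<Rightarrow> nat" where
  "turan_sum r d a n = Max (edges ` turan_graphs r d a n)"

definition turan_prod :: "nat \<Rightarrow> nat \<Rightarrow> nat \<Rightarrow> nat \<Rightarrow> nat" where
  "turan_prod r d a n = Max (edge_product ` turan_graphs r d a n)"

end

theory Submission
  imports Defs Complex_Main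
begin

text \<open>
  Let \<open>G\<close> be an \<open>n\<close>-vertex multigraph whose \<open>(s + 1)\<close>-sets span at most \<open>\<Sigma>(s + 1)\<close> edges. If no
  \<open>s\<close>-set spans more than \<open>\<Sigma>(s)\<close> edges, the hypothesis applies. Otherwise pick an \<open>s\<close>-set \<open>X\<close>
  spanning at least \<open>\<Sigma>(s) + 1\<close> edges: every outside vertex then sends at most
  \<open>\<Sigma>(s + 1) - \<Sigma>(s) - 1\<close> edges to \<open>X\<close>. With \<open>D = 1 + (r - 1)(d + 1)\<close>, this is at most
  \<open>s (a + 1 - (d + 1) / D) - 1 / D\<close>, as one sees by deleting a suitable vertex from an optimal
  graph on \<open>s + 1\<close> vertices. On the other hand, averaging over the parts shows that a vertex can be
  added to a Turan-type graph on \<open>m\<close> vertices such that the product gains a factor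
  \<open>a^m exp (m (1 - (d + 1) / D) / a - O(m / a^2))\<close>. Since \<open>w \<le> a exp ((w - a) / a)\<close>, deleting \<open>X\<close>
  increases the ratio of \<open>P(G)\<close> to \<open>\<Pi>(n)\<close> by a factor of at least \<open>exp ((n / (2 D) - O(1)) / a)\<close>.
  Iterating, one either reaches a graph to which the hypothesis applies, or a graph of bounded order,
  for which the ratio is at most \<open>exp (O(1) / a)\<close>. All exponents scale as \<open>1 / a\<close>, so the threshold
  for \<open>n\<close> does not depend on \<open>a\<close>.
\<close>

section \<open>Sums and products over the pairs of a vertex set\<close>

lemma nsets_2_insert:
  assumes "v \<notin> V"
  shows "[insert v V]\<^bsup>2\<^esup> = [V]\<^bsup>2\<^esup> \<union> (\<lambda>x. {x, v}) ` V"
    and "[V]\<^bsup>2\<^esup> \<inter> (\<lambda>x. {x, v}) ` V = {}" and "inj_on (\<lambda>x. {x, v}) V"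
  using assms
  by (auto simp: nsets_2_eq inj_on_def doubleton_eq_iff)

lemma sum_nsets_2_insert:
  fixes f :: "'a set \<Rightarrow> 'b::comm_monoid_add"
  assumes "finite V" "v \<notin> V"
  shows "sum f ([insert v V]\<^bsup>2\<^esup>) = sum f ([V]\<^bsup>2\<^esup>) + (\<Sum>x\<in>V. f {x, v})"
  using nsets_2_insert[OF assms(2)] assms(1)
  by (simp add: sum.union_disjoint sum.reindex finite_imp_finite_nsets)

lemma prod_nsets_2_insert:
  fixes f :: "'a set \<Rightarrow> 'b::comm_monoid_mult"
  assumes "finite V" "v \<notin> V"
  shows "prod f ([insert v V]\<^bsup>2\<^esup>) = prod f ([V]\<^bsup>2\<^esup>) * (\<Prod>x\<in>V. f {x, v})"
  using nsets_2_insert[OF assms(2)] assms(1)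
  by (simp add: prod.union_disjoint prod.reindex finite_imp_finite_nsets)

lemma sum_nsets_2_Un:
  fixes f :: "'a set \<Rightarrow> 'b::comm_monoid_add"
  assumes "finite X" "finite Y" "X \<inter> Y = {}"
  shows "sum f ([Y \<union> X]\<^bsup>2\<^esup>) = sum f ([X]\<^bsup>2\<^esup>) + sum f ([Y]\<^bsup>2\<^esup>) + (\<Sum>v\<in>Y. \<Sum>x\<in>X. f {x, v})"
  using assms(2,3)
proof (induction Y rule: finite_induct)
  case (insert v Y)
  have "sum f ([insert v (Y \<union> X)]\<^bsup>2\<^esup>) = sum f ([Y \<union> X]\<^bsup>2\<^esup>) + (\<Sum>x\<in>Y \<union> X. f {x, v})"
    using insert assms(1) by (intro sum_nsets_2_insert) auto
  moreover have "(\<Sum>x\<in>Y \<union> X. f {x, v}) = (\<Sum>x\<in>Y. f {x, v}) + (\<Sum>x\<in>X. f {x, v})"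
    using insert assms(1) by (intro sum.union_disjoint) auto
  ultimately show ?case
    using insert by (simp add: sum_nsets_2_insert ac_simps)
qed (simp add: nsets_2_eq)

text \<open>Double counting: a pair survives exactly the deletions of the \<open>card V - 2\<close>
  vertices outside it.\<close>

lemma sum_nsets_2_remove:
  fixes w :: "'a set \<Rightarrow> nat"
  assumes "finite V"
  shows "(\<Sum>v\<in>V. sum w ([V - {v}]\<^bsup>2\<^esup>)) = (card V - 2) * sum w ([V]\<^bsup>2\<^esup>)"
proof -
  have fin: "finite ([V]\<^bsup>2\<^esup>)" using assms by (rule finite_imp_finite_nsets)
  have "(\<Sum>v\<in>V. sum w ([V - {v}]\<^bsup>2\<^esup>)) = (\<Sum>v\<in>V. \<Sum>e\<in>{e\<in>[V]\<^bsup>2\<^esup>. v \<notin> e}. w e)"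
    by (intro sum.cong) (auto simp: nsets_def)
  also have "\<dots> = (\<Sum>e\<in>[V]\<^bsup>2\<^esup>. \<Sum>v\<in>{v\<in>V. v \<notin> e}. w e)"
    using assms fin by (rule sum.swap_restrict)
  also have "\<dots> = (\<Sum>e\<in>[V]\<^bsup>2\<^esup>. (card V - 2) * w e)"
  proof (intro sum.cong refl)
    fix e assume "e \<in> [V]\<^bsup>2\<^esup>"
    then have "e \<subseteq> V" "finite e" "card e = 2" by (auto simp: nsets_def)
    moreover have "{v\<in>V. v \<notin> e} = V - e" by auto
    ultimately show "(\<Sum>v\<in>{v\<in>V. v \<notin> e}. w e) = (card V - 2) * w e"
      by (simp add: card_Diff_subset)
  qed
  finally show ?thesis by (simp add: sum_distrib_left)
qed

lemma choose_two_Suc: "(Suc n choose 2) = (n choose 2) + n"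
  by (simp add: numeral_2_eq_2)

text \<open>Average multiplicity at most \<open>b\<close> passes from the vertex-deleted subsets to
  the whole set by averaging over the deleted vertex, so it climbs from \<open>k\<close>-sets up to
  \<open>V\<close>. This later bounds the total multiplicity of graphs of bounded order.\<close>

lemma sum_nsets_2_le_density:
  fixes w :: "'a set \<Rightarrow> nat"
  assumes "finite V" "k \<ge> 2" "k \<le> card V"
    and "\<And>Y. Y \<in> [V]\<^bsup>k\<^esup> \<Longrightarrow> sum w ([Y]\<^bsup>2\<^esup>) \<le> b * (k choose 2)"
  shows "sum w ([V]\<^bsup>2\<^esup>) \<le> b * (card V choose 2)"
  using assms
proof (induction "card V - k" arbitrary: V)
  case 0
  then have "V \<in> [V]\<^bsup>k\<^esup>" by (auto simp: nsets_def)
  with 0 show ?case by fastforce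
next
  case (Suc m)
  define n where "n = card V - 1"
  have n: "card V = Suc n" "n \<ge> 2" using Suc n_def by auto
  have "sum w ([V - {v}]\<^bsup>2\<^esup>) \<le> b * (n choose 2)" if "v \<in> V" for v
  proof -
    have c: "card (V - {v}) = n" using that n Suc by simp
    have "sum w ([V - {v}]\<^bsup>2\<^esup>) \<le> b * (card (V - {v}) choose 2)"
    proof (rule Suc.hyps(1))
      fix Y assume "Y \<in> [V - {v}]\<^bsup>k\<^esup>"
      then have "Y \<in> [V]\<^bsup>k\<^esup>" by (auto simp: nsets_def)
      then show "sum w ([Y]\<^bsup>2\<^esup>) \<le> b * (k choose 2)" by (rule Suc.prems)
    qed (use Suc n c in auto)
    with c show ?thesis by simp
  qed
  then have "(n - 1) * sum w ([V]\<^bsup>2\<^esup>) \<le> card V * (b * (n choose 2))"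
    using sum_nsets_2_remove[OF Suc.prems(1), of w] sum_bounded_above[of V "\<lambda>v. sum w ([V - {v}]\<^bsup>2\<^esup>)"] n
    by simp
  also have "\<dots> = (n - 1) * (b * (Suc n choose 2))"
  proof -
    have "even (n * (n - 1))" by (cases n) auto
    then have "2 * (n choose 2) = n * (n - 1)" "2 * (Suc n choose 2) = Suc n * n"
      by (simp_all add: choose_two)
    then have "2 * (Suc n * (n choose 2)) = 2 * ((n - 1) * (Suc n choose 2))"
      by (metis mult.assoc mult.commute mult.left_commute)
    then have "Suc n * (n choose 2) = (n - 1) * (Suc n choose 2)" by simp
    then show ?thesis using n by (metis mult.left_commute)
  qed
  finally show ?case using n by simp
qed

text \<open>Termwise this is \<open>1 + t \<le> exp t\<close> with \<open>t = (f x - a) / a\<close>.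
  It turns an upper bound on a sum of multiplicities into one on their product, with the main power
  of \<open>a\<close> split off.\<close>

lemma prod_le_exp_excess:
  fixes f :: "'a \<Rightarrow> real" and a :: real
  assumes "a > 0" "\<And>x. x \<in> A \<Longrightarrow> f x \<ge> 0"
  shows "prod f A \<le> a ^ card A * exp ((sum f A - a * card A) / a)"
proof -
  have "f x \<le> a * exp ((f x - a) / a)" if "x \<in> A" for x
  proof -
    have "f x / a \<le> exp ((f x - a) / a)"
      using exp_ge_add_one_self[of "(f x - a) / a"] assms(1) by (simp add: field_simps)
    then show ?thesis using assms(1) by (simp add: field_simps)
  qed
  then have "prod f A \<le> (\<Prod>x\<in>A. a * exp ((f x - a) / a))"
    using assms by (intro prod_mono) auto
  also have "\<dots> = a ^ card A * exp (\<Sum>x\<in>A. (f x - a) / a)"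
    by (cases "finite A") (auto simp: prod.distrib exp_sum)
  also have "(\<Sum>x\<in>A. (f x - a) / a) = (sum f A - a * card A) / a"
    by (simp add: sum_subtractf flip: sum_divide_distrib)
  finally show ?thesis .
qed

section \<open>Turan-type multigraphs as colourings\<close>

text \<open>The Turan-type multigraphs are encoded by colourings \<open>c\<close> of the vertices with the
  indices of the parts.\<close>

definition turan_mult :: "nat \<Rightarrow> nat \<Rightarrow> ('a \<Rightarrow> nat) \<Rightarrow> 'a set \<Rightarrow> nat" where
  "turan_mult d a c e = (if c ` e = {0} then a - d else if is_singleton (c ` e) then a else a + 1)"

lemma turan_mult_pair:
  "turan_mult d a c {x, y} = (if c x \<noteq> c y then a + 1 else if c x = 0 then a - d else a)"
  by (auto simp: turan_mult_def is_singleton_def doubleton_eq_iff)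

lemma turan_mult_image: "turan_mult d a c (h ` e) = turan_mult d a (c \<circ> h) e"
  by (simp add: turan_mult_def image_comp)

lemma turan_mult_le: "turan_mult d a c e \<le> a + 1"
  by (simp add: turan_mult_def le_SucI)

text \<open>The colour of a vertex is the index of its part and, conversely, the parts are the
  colour classes. Afterwards the quantifier over partitions never has to be unfolded again.\<close>

lemma turan_graphs_iff:
  assumes "r > 0"
  shows "G \<in> turan_graphs r d a n \<longleftrightarrow>
    (\<exists>c \<in> {1..n} \<rightarrow> {..<r}. G = ({1..n}, restrict (turan_mult d a c) ([{1..n}]\<^bsup>2\<^esup>)))"
proof
  assume "G \<in> turan_graphs r d a n"
  then obtain V :: "nat \<Rightarrow> nat set" where
    G: "multigraph G" "fst G = {1..n}" and
    V: "disjoint_family_on V {..<r}" "(\<Union>i<r. V i) = {1..n}"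
       "\<And>e. e\<in>[V 0]\<^bsup>2\<^esup> \<Longrightarrow> snd G e = a - d"
       "\<And>i e. i\<in>{1..<r} \<Longrightarrow> e\<in>[V i]\<^bsup>2\<^esup> \<Longrightarrow> snd G e = a"
       "\<And>e. e\<in>[{1..n}]\<^bsup>2\<^esup> \<Longrightarrow> (\<forall>i<r. e \<notin> [V i]\<^bsup>2\<^esup>) \<Longrightarrow> snd G e = a + 1"
    unfolding turan_graphs_def by auto
  have "\<exists>i<r. x \<in> V i" if "x \<in> {1..n}" for x using that V(2) by blast
  then obtain c where c: "\<And>x. x \<in> {1..n} \<Longrightarrow> c x < r \<and> x \<in> V (c x)" by metis
  \<comment> \<open>Disjointness of the parts makes the colour unique, so vertices of different
    colours share no part.\<close>
  have cV: "c x = i" if "x \<in> V i" "i < r" for x i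
  proof -
    have "x \<in> {1..n}" using that V(2) by blast
    then show ?thesis using c[of x] that V(1) by (auto simp: disjoint_family_on_def)
  qed
  have "snd G e = turan_mult d a c e" if e: "e \<in> [{1..n}]\<^bsup>2\<^esup>" for e
  proof -
    obtain x y where xy: "e = {x, y}" "x \<noteq> y" "x \<in> {1..n}" "y \<in> {1..n}"
      using e by (auto simp: nsets_def card_2_iff)
    show ?thesis
    proof (cases "c x = c y")
      case True
      then have *: "e \<in> [V (c x)]\<^bsup>2\<^esup>" using c[OF xy(3)] c[OF xy(4)] xy by (auto simp: nsets_2_eq)
      show ?thesis
      proof (cases "c x = 0")
        case True
        then show ?thesis using * V(3)[of e] \<open>c x = c y\<close> by (simp add: xy(1) turan_mult_pair)
      next
        case False
        then have "c x \<in> {1..<r}" using c[OF xy(3)] by auto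
        then show ?thesis using V(4)[OF _ *] False \<open>c x = c y\<close>
          by (simp add: xy(1) turan_mult_pair)
      qed
    next
      case False
      have "\<forall>i<r. e \<notin> [V i]\<^bsup>2\<^esup>"
        using False cV by (auto simp: nsets_def xy(1))
      then show ?thesis using V(5)[OF e] False by (simp add: xy(1) turan_mult_pair)
    qed
  qed
  then have "snd G = restrict (turan_mult d a c) ([{1..n}]\<^bsup>2\<^esup>)"
    using G by (intro extensionalityI[where A = "[{1..n}]\<^bsup>2\<^esup>"]) (simp_all add: multigraph_def PiE_def)
  moreover have "c \<in> {1..n} \<rightarrow> {..<r}" using c by auto
  ultimately show "\<exists>c \<in> {1..n} \<rightarrow> {..<r}. G = ({1..n}, restrict (turan_mult d a c) ([{1..n}]\<^bsup>2\<^esup>))"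
    by (intro bexI[of _ c] prod_eqI) (simp_all only: G(2) fst_conv snd_conv)
next
  assume "\<exists>c \<in> {1..n} \<rightarrow> {..<r}. G = ({1..n}, restrict (turan_mult d a c) ([{1..n}]\<^bsup>2\<^esup>))"
  then obtain c where c: "c \<in> {1..n} \<rightarrow> {..<r}"
    and G: "G = ({1..n}, restrict (turan_mult d a c) ([{1..n}]\<^bsup>2\<^esup>))" by blast
  define V where "V i = {x \<in> {1..n}. c x = i}" for i
  have pair: "\<exists>x y. e = {x, y} \<and> c x = i \<and> c y = i \<and> e \<in> [{1..n}]\<^bsup>2\<^esup>" if "e \<in> [V i]\<^bsup>2\<^esup>" for e i
    using that by (fastforce simp: nsets_def card_2_iff V_def)
  have "snd G e = a - d" if "e \<in> [V 0]\<^bsup>2\<^esup>" for e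
    using pair[OF that] by (auto simp: G turan_mult_pair)
  moreover have "snd G e = a" if "i \<in> {1..<r}" "e \<in> [V i]\<^bsup>2\<^esup>" for i e
    using pair[OF that(2)] that(1) by (auto simp: G turan_mult_pair)
  moreover have "snd G e = a + 1" if e: "e \<in> [{1..n}]\<^bsup>2\<^esup>" "\<forall>i<r. e \<notin> [V i]\<^bsup>2\<^esup>" for e
  proof -
    obtain x y where xy: "e = {x, y}" "x \<noteq> y" "x \<in> {1..n}" "y \<in> {1..n}"
      using e by (auto simp: nsets_def card_2_iff)
    have "c x < r" using c xy by auto
    then have "e \<notin> [V (c x)]\<^bsup>2\<^esup>" using e(2) by blast
    then have "c x \<noteq> c y" using xy by (auto simp: nsets_2_eq V_def)
    then show ?thesis using e(1) by (simp add: G xy(1) turan_mult_pair)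
  qed
  moreover have "disjoint_family_on V {..<r}" "(\<Union>i<r. V i) = {1..n}"
    using c by (auto simp: V_def disjoint_family_on_def)
  moreover have "multigraph G" "fst G = {1..n}" by (auto simp: G multigraph_def)
  ultimately show "G \<in> turan_graphs r d a n"
    unfolding turan_graphs_def by auto
qed

lemma edges_restrict: "edges (V, restrict f ([V]\<^bsup>2\<^esup>)) = sum f ([V]\<^bsup>2\<^esup>)"
  and edge_product_restrict: "edge_product (V, restrict f ([V]\<^bsup>2\<^esup>)) = prod f ([V]\<^bsup>2\<^esup>)"
  by (auto simp: edges_def edges_in_def edge_product_def)

lemma edges_turan_graphs:
  assumes "r > 0"
  shows "edges ` turan_graphs r d a n =
    (\<lambda>c. sum (turan_mult d a c) ([{1..n}]\<^bsup>2\<^esup>)) ` ({1..n} \<rightarrow> {..<r})"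
  by (auto simp: turan_graphs_iff[OF assms] edges_restrict image_iff Bex_def; metis edges_restrict)

lemma edge_product_turan_graphs:
  assumes "r > 0"
  shows "edge_product ` turan_graphs r d a n =
    (\<lambda>c. prod (turan_mult d a c) ([{1..n}]\<^bsup>2\<^esup>)) ` ({1..n} \<rightarrow> {..<r})"
  by (auto simp: turan_graphs_iff[OF assms] edge_product_restrict image_iff Bex_def; metis edge_product_restrict)

text \<open>Colourings are unconstrained outside the vertex set, so there may be infinitely many of
  them. Finiteness of the values comes instead from the bound \<open>a + 1\<close> on every
  multiplicity.\<close>

lemma finite_turan_values:
  fixes V :: "'a set"
  shows "finite ((\<lambda>c. sum (turan_mult d a c) ([V]\<^bsup>2\<^esup>)) ` C)"
    "finite ((\<lambda>c. prod (turan_mult d a c) ([V]\<^bsup>2\<^esup>)) ` C)"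
proof -
  have "sum (turan_mult d a c) ([V]\<^bsup>2\<^esup>) \<le> card ([V]\<^bsup>2\<^esup>) * (a + 1)" for c
    using sum_bounded_above[of "[V]\<^bsup>2\<^esup>" "turan_mult d a c" "a + 1"] turan_mult_le by auto
  then show "finite ((\<lambda>c. sum (turan_mult d a c) ([V]\<^bsup>2\<^esup>)) ` C)"
    by (intro finite_subset[OF _ finite_atMost[of "card ([V]\<^bsup>2\<^esup>) * (a + 1)"]]) auto
  have "prod (turan_mult d a c) ([V]\<^bsup>2\<^esup>) \<le> (\<Prod>e\<in>[V]\<^bsup>2\<^esup>. a + 1)" for c
    by (intro prod_mono) (use turan_mult_le in auto)
  then show "finite ((\<lambda>c. prod (turan_mult d a c) ([V]\<^bsup>2\<^esup>)) ` C)"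
    by (intro finite_subset[OF _ finite_atMost[of "\<Prod>e\<in>[V]\<^bsup>2\<^esup>. a + 1"]]) auto
qed

lemma turan_sum_attained:
  assumes "r > 0"
  obtains c where "c \<in> {1..n} \<rightarrow> {..<r}"
    "turan_sum r d a n = sum (turan_mult d a c) ([{1..n}]\<^bsup>2\<^esup>)"
proof -
  have "{1..n} \<rightarrow> {..<r} \<noteq> {}" using assms by (auto simp: Pi_eq_empty)
  then have "turan_sum r d a n \<in> (\<lambda>c. sum (turan_mult d a c) ([{1..n}]\<^bsup>2\<^esup>)) ` ({1..n} \<rightarrow> {..<r})"
    unfolding turan_sum_def edges_turan_graphs[OF assms]
    by (intro Max_in finite_turan_values) auto
  then show ?thesis using that by blast
qed

lemma turan_prod_attained:
  assumes "r > 0"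
  obtains c where "c \<in> {1..n} \<rightarrow> {..<r}"
    "turan_prod r d a n = prod (turan_mult d a c) ([{1..n}]\<^bsup>2\<^esup>)"
proof -
  have "{1..n} \<rightarrow> {..<r} \<noteq> {}" using assms by (auto simp: Pi_eq_empty)
  then have "turan_prod r d a n \<in> (\<lambda>c. prod (turan_mult d a c) ([{1..n}]\<^bsup>2\<^esup>)) ` ({1..n} \<rightarrow> {..<r})"
    unfolding turan_prod_def edge_product_turan_graphs[OF assms]
    by (intro Max_in finite_turan_values) auto
  then show ?thesis using that by blast
qed

text \<open>A bijection with \<open>{1..card V}\<close> transports the colouring. Arbitrary
  \<open>V\<close> is needed for subsets of \<open>{1..n}\<close> and for \<open>{1..s+1}\<close>
  with a vertex deleted.\<close>

lemma turan_sum_upper: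
  assumes "r > 0" "finite V" "c \<in> V \<rightarrow> {..<r}"
  shows "sum (turan_mult d a c) ([V]\<^bsup>2\<^esup>) \<le> turan_sum r d a (card V)"
proof -
  obtain h where h: "bij_betw h {1..card V} V"
    using assms(2) ex_bij_betw_nat_finite_1 by blast
  have "sum (turan_mult d a c) ([V]\<^bsup>2\<^esup>) = sum (turan_mult d a (c \<circ> h)) ([{1..card V}]\<^bsup>2\<^esup>)"
    by (simp flip: turan_mult_image sum.reindex_bij_betw[OF bij_betw_nsets[OF h]])
  moreover have "c \<circ> h \<in> {1..card V} \<rightarrow> {..<r}"
    using h assms(3) by (fastforce simp: bij_betw_def)
  ultimately show ?thesis
    unfolding turan_sum_def edges_turan_graphs[OF assms(1)]
    by (intro Max_ge finite_turan_values) auto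
qed

lemma turan_prod_upper:
  assumes "r > 0" "c \<in> {1..n} \<rightarrow> {..<r}"
  shows "prod (turan_mult d a c) ([{1..n}]\<^bsup>2\<^esup>) \<le> turan_prod r d a n"
  unfolding turan_prod_def edge_product_turan_graphs[OF assms(1)]
  using assms by (intro Max_ge finite_turan_values) auto

lemma turan_prod_pos:
  assumes "r > 0" "a > d"
  shows "turan_prod r d a n > 0"
proof -
  obtain c where "turan_prod r d a n = prod (turan_mult d a c) ([{1..n}]\<^bsup>2\<^esup>)"
    using turan_prod_attained[OF assms(1)] by metis
  then show ?thesis using assms by (auto intro!: prod_pos simp: turan_mult_def)
qed

lemma turan_sum_le: 
  assumes "r > 0"
  shows "turan_sum r d a n \<le> (a + 1) * (n choose 2)"
proof -
  obtain c where "turan_sum r d a n = sum (turan_mult d a c) ([{1..n}]\<^bsup>2\<^esup>)"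
    using turan_sum_attained[OF assms(1)] by metis
  then show ?thesis
    using sum_bounded_above[of "[{1..n}]\<^bsup>2\<^esup>" "turan_mult d a c" "a + 1"] turan_mult_le
    by (auto simp: mult.commute)
qed

section \<open>Colour classes and deficits\<close>

lemma card_colour_classes:
  fixes c :: "'a \<Rightarrow> nat"
  assumes "finite V" "c \<in> V \<rightarrow> {..<r}" "r > 0"
  shows "card V = card {x\<in>V. c x = 0} + (\<Sum>i\<in>{1..<r}. card {x\<in>V. c x = i})"
proof -
  have "card V = card (\<Union>i\<in>{..<r}. {x\<in>V. c x = i})"
    using assms(2) by (intro arg_cong[where f=card]) auto
  also have "\<dots> = (\<Sum>i\<in>{..<r}. card {x\<in>V. c x = i})"
    using assms(1) by (subst card_UN_disjoint) auto
  also have "{..<r} = insert 0 {1..<r}" using assms(3) by auto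
  finally show ?thesis by simp
qed

text \<open>The number of edges lost, relative to multiplicity \<open>a + 1\<close> everywhere, by a vertex
  of colour \<open>i\<close> joined to \<open>V\<close>.\<close>

definition deficit :: "nat \<Rightarrow> ('a \<Rightarrow> nat) \<Rightarrow> 'a set \<Rightarrow> nat \<Rightarrow> nat" where
  "deficit d c V i = (if i = 0 then d + 1 else 1) * card {x\<in>V. c x = i}"

lemma sum_turan_mult_star:
  assumes "finite V" "a \<ge> d"
  shows "(\<Sum>x\<in>V. turan_mult d a c {x, v}) + deficit d c V (c v) = (a + 1) * card V"
proof -
  have "(\<Sum>x\<in>V. turan_mult d a c {x, v}) + deficit d c V (c v)
     = (\<Sum>x\<in>V. turan_mult d a c {x, v} + (if c x = c v then if c v = 0 then d + 1 else 1 else 0))"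
    using assms(1) by (simp add: sum.distrib deficit_def Int_def flip: sum.inter_filter)
  also have "\<dots> = (\<Sum>x\<in>V. a + 1)"
    using assms(2) by (intro sum.cong) (auto simp: turan_mult_pair)
  finally show ?thesis by simp
qed

text \<open>Weighted averaging: with weight \<open>1\<close> for colour 0 and \<open>d + 1\<close>
  for every other colour, the deficits sum to \<open>(d + 1) * card V\<close>, while the weights sum
  to \<open>D = 1 + (r - 1) * (d + 1)\<close>.\<close>

lemma exists_small_deficit:
  assumes "r > 0" "finite V" "c \<in> V \<rightarrow> {..<r}"
  obtains i where "i < r" "(1 + (r - 1) * (d + 1)) * deficit d c V i \<le> (d + 1) * card V"
proof -
  define D where "D = 1 + (r - 1) * (d + 1)"
  define v where "v i = card {x\<in>V. c x = i}" for i
  have "\<exists>i<r. D * deficit d c V i \<le> (d + 1) * card V"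
  proof (rule ccontr)
    assume "\<not> ?thesis"
    then have *: "D * deficit d c V i > (d + 1) * card V" if "i < r" for i
      using that by (simp add: not_le)
    have "(d + 1) * card V < (d + 1) * (D * v 0)"
      using *[of 0] assms(1) by (simp add: deficit_def v_def algebra_simps)
    then have "card V < D * v 0" by (meson mult_less_cancel1)
    moreover have "(\<Sum>i\<in>{1..<r}. (d + 1) * card V) \<le> (\<Sum>i\<in>{1..<r}. D * v i)"
    proof (rule sum_mono)
      fix i assume "i \<in> {1..<r}"
      then show "(d + 1) * card V \<le> D * v i" using *[of i] by (simp add: deficit_def v_def)
    qed
    moreover have "D * card V = D * v 0 + (\<Sum>i\<in>{1..<r}. D * v i)"
      using card_colour_classes[OF assms(2,3,1)]
      by (simp add: v_def distrib_left sum_distrib_left)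
    ultimately have "card V + (r - 1) * ((d + 1) * card V) < D * card V" by simp
    then show False by (simp add: D_def algebra_simps)
  qed
  then show ?thesis using that unfolding D_def by blast
qed

text \<open>The same weights in the opposite direction: if the inequality failed at every vertex,
  each class would be too small for the classes to have \<open>s + 1\<close> vertices altogether.
  Integrality improves the strict inequality by 1, which yields the term \<open>1 / D\<close> in the
  increment of \<open>turan_sum\<close>, the source of all later gains.\<close>

lemma exists_large_deficit:
  assumes "r > 0" "finite V" "c \<in> V \<rightarrow> {..<r}" "card V = s + 1"
  obtains v where "v \<in> V"
    "(1 + (r - 1) * (d + 1)) * (deficit d c (V - {v}) (c v) + 1) \<ge> s * (d + 1) + 1"
proof -
  define D where "D = 1 + (r - 1) * (d + 1)"
  define u where "u i = card {x\<in>V. c x = i}" for i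
  have "\<exists>v\<in>V. D * (deficit d c (V - {v}) (c v) + 1) > s * (d + 1)"
  proof (rule ccontr)
    assume "\<not> ?thesis"
    then have *: "D * (deficit d c (V - {v}) (c v) + 1) \<le> s * (d + 1)" if "v \<in> V" for v
      using that by (simp add: not_less)
    have del: "card {x \<in> V - {v}. c x = c v} + 1 = u (c v)" if "v \<in> V" for v
    proof -
      have "{x\<in>V. c x = c v} = insert v {x \<in> V - {v}. c x = c v}" using that by auto
      then show ?thesis using assms(2) by (simp add: u_def)
    qed
    \<comment> \<open>Leaving out a vertex of colour 0 lowers its class's deficit by
      \<open>d + 1\<close>, of which the summand 1 restores only one unit. The missing
      \<open>d\<close> units give the term \<open>D * d\<close>, still short of the
      \<open>D * (d + 1)\<close> needed to avoid a contradiction.\<close>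
    have u0: "(d + 1) * (D * u 0) \<le> s * (d + 1) + D * d"
    proof (cases "u 0 = 0")
      case False
      then obtain v where v: "v \<in> V" "c v = 0" using assms(2) by (auto simp: u_def)
      obtain k where k: "u 0 = Suc k" using False by (cases "u 0") auto
      have "D * ((d + 1) * k + 1) \<le> s * (d + 1)"
        using *[OF v(1)] del[OF v(1)] v(2) k by (simp add: deficit_def)
      then show ?thesis by (simp add: k algebra_simps)
    qed simp
    have ui: "D * u i \<le> s * (d + 1)" if "i \<in> {1..<r}" for i
    proof (cases "u i = 0")
      case False
      then obtain v where v: "v \<in> V" "c v = i" using assms(2) by (auto simp: u_def)
      have "D * (card {x \<in> V - {v}. c x = c v} + 1) \<le> s * (d + 1)"
        using *[OF v(1)] v(2) that by (simp add: deficit_def)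
      then show ?thesis unfolding del[OF v(1)] unfolding v(2) .
    qed simp
    have "(\<Sum>i\<in>{1..<r}. (d + 1) * (D * u i)) \<le> (\<Sum>i\<in>{1..<r}. (d + 1) * (s * (d + 1)))"
      by (intro sum_mono mult_left_mono ui) auto
    moreover have "(d + 1) * (D * (s + 1)) = (d + 1) * (D * u 0) + (\<Sum>i\<in>{1..<r}. (d + 1) * (D * u i))"
      using card_colour_classes[OF assms(2,3,1)] assms(4)
      by (simp add: u_def distrib_left sum_distrib_left flip: assms(4))
    ultimately have "(d + 1) * (D * (s + 1)) \<le> s * (d + 1) + D * d + (r - 1) * ((d + 1) * (s * (d + 1)))"
      using u0 by simp
    also have "\<dots> = s * (d + 1) * D + D * d"
    proof -
      have "s * (d + 1) * D = s * (d + 1) + (r - 1) * ((d + 1) * (s * (d + 1)))"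
        unfolding D_def by algebra
      then show ?thesis by simp
    qed
    finally have "D * (d + 1) \<le> D * d" by (simp add: algebra_simps)
    then show False by (simp add: D_def)
  qed
  then show ?thesis using that unfolding D_def by (metis Suc_eq_plus1 Suc_leI)
qed

section \<open>Increments of the extremal sum and product\<close>

text \<open>The left side will bound the excess, over multiplicity \<open>a\<close>, of the edges
  from an outside vertex to an \<open>s\<close>-set with more than \<open>turan_sum r d a s\<close>
  edges. Deleting a vertex of large deficit from an optimal colouring leaves at most
  \<open>turan_sum r d a s\<close> edges, and the deficit controls the edges removed.\<close>

lemma turan_sum_increment:
  fixes D :: nat
  assumes "r > 0" "a \<ge> d" and D: "D = 1 + (r - 1) * (d + 1)"
  shows "real (turan_sum r d a (s + 1)) - turan_sum r d a s - 1 - a * s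
    \<le> s * (1 - (d + 1) / D) - 1 / D"
proof -
  obtain c where c: "c \<in> {1..s+1} \<rightarrow> {..<r}"
    "turan_sum r d a (s + 1) = sum (turan_mult d a c) ([{1..s+1}]\<^bsup>2\<^esup>)"
    using turan_sum_attained[OF assms(1)] by metis
  obtain v where v: "v \<in> {1..s+1}"
    and large: "D * (deficit d c ({1..s+1} - {v}) (c v) + 1) \<ge> s * (d + 1) + 1"
    using exists_large_deficit[OF assms(1) _ c(1), of s d] D by auto
  define W where "W = {1..s+1} - {v}"
  define \<delta> where "\<delta> = deficit d c W (c v)"
  have W: "finite W" "v \<notin> W" "insert v W = {1..s+1}" "card W = s" "c \<in> W \<rightarrow> {..<r}"
    using v c(1) by (auto simp: W_def)
  have "turan_sum r d a (s + 1) = sum (turan_mult d a c) ([W]\<^bsup>2\<^esup>) + (\<Sum>x\<in>W. turan_mult d a c {x, v})"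
    using sum_nsets_2_insert[OF W(1,2), of "turan_mult d a c"] W(3) c(2) by simp
  moreover have "sum (turan_mult d a c) ([W]\<^bsup>2\<^esup>) \<le> turan_sum r d a s"
    using turan_sum_upper[OF assms(1) W(1,5)] W(4) by simp
  moreover have "(\<Sum>x\<in>W. turan_mult d a c {x, v}) + \<delta> = (a + 1) * s"
    using sum_turan_mult_star[OF W(1) assms(2), of c v] W(4) by (simp add: \<delta>_def)
  ultimately have "turan_sum r d a (s + 1) + \<delta> \<le> turan_sum r d a s + (a + 1) * s"
    by linarith
  then have "real (turan_sum r d a (s + 1) + \<delta>) \<le> real (turan_sum r d a s + (a + 1) * s)"
    by (simp only: of_nat_le_iff)
  then have 1: "real (turan_sum r d a (s + 1)) - turan_sum r d a s - 1 - a * s \<le> s - real (\<delta> + 1)"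
    by (simp add: algebra_simps)
  have "real (s * (d + 1) + 1) \<le> real (D * (\<delta> + 1))"
    using large unfolding \<delta>_def W_def of_nat_le_iff by simp
  moreover have "real D > 0" using D by (simp only: of_nat_0_less_iff)
  ultimately have "(s * (d + 1) + 1) / D \<le> real (\<delta> + 1)"
    by (simp add: field_simps)
  moreover have "(s * (d + 1) + 1) / D = s * ((d + 1) / D) + 1 / D"
    by (simp add: add_divide_distrib distrib_left)
  ultimately show ?thesis using 1 by (simp add: right_diff_distrib add_ac)
qed

text \<open>Write a multiplicity \<open>m\<close> as \<open>a * exp (ln (m / a))\<close> and expand
  the logarithm to second order at \<open>1 / a\<close>, \<open>0\<close> or \<open>- d / a\<close>.
  The assumption \<open>a \<ge> 2 * d\<close> keeps the argument within the range of the estimates,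
  and \<open>d > 0\<close> lets one error term serve all three cases.\<close>

lemma turan_mult_lower:
  fixes a d :: nat
  assumes "d > 0" "a \<ge> 2 * d"
  shows "a * exp ((1 - (if c x = c y then if c y = 0 then real d + 1 else 1 else 0)) / a - 2 * (real d)^2 / (real a)^2)
    \<le> turan_mult d a c {x, y}"
proof -
  have a: "real a > 0" using assms by simp
  have exp_le: "a * exp t \<le> m" if "t \<le> ln (m / a)" "m > 0" for t m :: real
  proof -
    have "exp t \<le> exp (ln (m / a))" using that by simp
    also have "\<dots> = m / a" using that a by simp
    finally show ?thesis using a by (simp add: field_simps)
  qed
  have d2: "1 / (real a)^2 \<le> 2 * (real d)^2 / (real a)^2"
  proof (intro divide_right_mono)
    have "1 \<le> (real d)^2" using assms by (intro one_le_power) simp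
    then show "1 \<le> 2 * (real d)^2" by simp
  qed simp
  have 1: "a * exp (1 / a - 2 * (real d)^2 / (real a)^2) \<le> a + 1"
  proof (rule exp_le)
    have "1 / real a - (1 / a)^2 \<le> ln (1 + 1 / a)"
      using assms a by (intro ln_one_plus_pos_lower_bound) auto
    moreover have "1 + 1 / real a = (a + 1) / a" using a by (simp add: field_simps)
    ultimately show "1 / real a - 2 * (real d)^2 / (real a)^2 \<le> ln ((a + 1) / a)"
      using d2 by (simp add: power_divide)
  qed simp
  have 2: "a * exp (- 2 * (real d)^2 / (real a)^2) \<le> a"
    using a by (simp add: mult_le_cancel_left1)
  have 3: "a * exp (- d / a - 2 * (real d)^2 / (real a)^2) \<le> real (a - d)"
  proof (rule exp_le)
    have "- (d / a) - 2 * (d / a)^2 \<le> ln (1 - d / real a)"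
      using assms a by (intro ln_one_minus_pos_lower_bound) (auto simp: field_simps)
    moreover have "1 - d / real a = (a - d) / a" using assms by (simp add: field_simps of_nat_diff)
    ultimately show "- d / a - 2 * (real d)^2 / (real a)^2 \<le> ln (real (a - d) / a)"
      by (simp add: power_divide)
  qed (use assms in simp)
  show ?thesis
    using 1 2 3 by (auto simp: turan_mult_pair)
qed

text \<open>Extend an optimal colouring by a new vertex whose colour has small deficit. Then
  \<kappa> bounds from below the average exponent of the \<open>n\<close> new pairs.\<close>

lemma turan_prod_increment:
  fixes a d r D :: nat and \<kappa> :: real
  assumes "r > 0" "d > 0" "a \<ge> 2 * d" and D: "D = 1 + (r - 1) * (d + 1)"
    and \<kappa>: "\<kappa> = (1 - (d + 1) / D) / a - 2 * (real d)^2 / (real a)^2"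
  shows "turan_prod r d a n * (a * exp \<kappa>) ^ n \<le> turan_prod r d a (Suc n)"
proof -
  obtain c where c: "c \<in> {1..n} \<rightarrow> {..<r}"
    "turan_prod r d a n = prod (turan_mult d a c) ([{1..n}]\<^bsup>2\<^esup>)"
    using turan_prod_attained[OF assms(1)] by metis
  obtain i where i: "i < r" "D * deficit d c {1..n} i \<le> (d + 1) * n"
    using exists_small_deficit[OF assms(1) _ c(1), of d] D by auto
  define c' where "c' = c(Suc n := i)"
  have ins: "insert (Suc n) {1..n} = {1..Suc n}" by auto
  have [simp]: "c' x = c x" if "x \<in> {1..n}" for x using that by (auto simp: c'_def)
  have [simp]: "c' (Suc n) = i" by (simp add: c'_def)
  \<comment> \<open>The exponent that \<open>turan_mult_lower\<close> provides for the pair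
    \<open>{x, Suc n}\<close>.\<close>
  define f where "f x = (1 - (if c x = i then if i = 0 then real d + 1 else 1 else 0)) / a
      - 2 * (real d)^2 / (real a)^2" for x
  have a: "real a > 0" using assms by simp
  have old: "turan_mult d a c' e = turan_mult d a c e" if "e \<in> [{1..n}]\<^bsup>2\<^esup>" for e
  proof -
    have "c' ` e = c ` e" using that by (intro image_cong) (auto simp: nsets_def)
    then show ?thesis by (simp add: turan_mult_def)
  qed
  have "(\<Sum>x\<in>{1..n}. f x) = (n - real (deficit d c {1..n} i)) / a - n * (2 * (real d)^2 / (real a)^2)"
  proof -
    have "(\<Sum>x\<in>{1..n}. if c x = i then if i = 0 then real d + 1 else 1 else 0)
        = real (deficit d c {1..n} i)"
      by (simp add: deficit_def sum.If_cases Int_def)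
    then show ?thesis
      by (simp add: f_def sum_subtractf flip: sum_divide_distrib)
  qed
  moreover have "n * (1 - (d + 1) / D) \<le> n - real (deficit d c {1..n} i)"
  proof -
    have "real (D * deficit d c {1..n} i) \<le> real ((d + 1) * n)"
      using i(2) by (simp only: of_nat_le_iff)
    moreover have "real D > 0" using D by (simp only: of_nat_0_less_iff)
    ultimately show ?thesis by (simp add: field_simps)
  qed
  ultimately have "n * \<kappa> \<le> (\<Sum>x\<in>{1..n}. f x)"
    using a by (simp add: \<kappa> right_diff_distrib divide_right_mono)
  then have "(a * exp \<kappa>) ^ n \<le> a ^ n * exp (\<Sum>x\<in>{1..n}. f x)"
    using a by (simp add: power_mult_distrib mult_left_mono flip: exp_of_nat_mult)
  also have "\<dots> = (\<Prod>x\<in>{1..n}. a * exp (f x))"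
    by (simp add: exp_sum prod.distrib)
  also have "\<dots> \<le> (\<Prod>x\<in>{1..n}. real (turan_mult d a c' {x, Suc n}))"
  proof (intro prod_mono conjI)
    fix x assume "x \<in> {1..n}"
    then show "a * exp (f x) \<le> real (turan_mult d a c' {x, Suc n})"
      using turan_mult_lower[OF assms(2,3), of c' x "Suc n"]
      by (simp only: f_def \<open>c' (Suc n) = i\<close> \<open>\<And>x. x \<in> {1..n} \<Longrightarrow> c' x = c x\<close>)
  qed simp
  finally have "turan_prod r d a n * (a * exp \<kappa>) ^ n
    \<le> turan_prod r d a n * (\<Prod>x\<in>{1..n}. real (turan_mult d a c' {x, Suc n}))"
    by (intro mult_left_mono) auto
  also have "\<dots> = real (prod (turan_mult d a c') ([{1..n}]\<^bsup>2\<^esup>) * (\<Prod>x\<in>{1..n}. turan_mult d a c' {x, Suc n}))"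
    using old by (simp add: c(2))
  also have "\<dots> = real (prod (turan_mult d a c') ([{1..Suc n}]\<^bsup>2\<^esup>))"
    using prod_nsets_2_insert[of "{1..n}" "Suc n" "turan_mult d a c'"] ins by simp
  also have "\<dots> \<le> turan_prod r d a (Suc n)"
  proof -
    have "c' \<in> {1..Suc n} \<rightarrow> {..<r}" using c(1) i(1) by (auto simp: c'_def)
    then show ?thesis using turan_prod_upper[OF assms(1)] unfolding of_nat_le_iff by blast
  qed
  finally show ?thesis .
qed

text \<open>Iterating the increment adds the exponents \<open>n\<close>, ...,
  \<open>n + k - 1\<close>, whose sum is the difference of binomial coefficients.\<close>

lemma turan_prod_growth:
  fixes a d r D :: nat and \<kappa> :: real
  assumes "r > 0" "d > 0" "a \<ge> 2 * d" and D: "D = 1 + (r - 1) * (d + 1)"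
    and \<kappa>: "\<kappa> = (1 - (d + 1) / D) / a - 2 * (real d)^2 / (real a)^2"
  shows "turan_prod r d a n * (a * exp \<kappa>) ^ ((n + k choose 2) - (n choose 2)) \<le> turan_prod r d a (n + k)"
proof (induction k)
  case (Suc k)
  have mono: "(n choose 2) \<le> (n + k choose 2)" by (induction k) (auto simp: choose_two_Suc)
  have "turan_prod r d a n * (a * exp \<kappa>) ^ ((n + Suc k choose 2) - (n choose 2))
    = turan_prod r d a n * (a * exp \<kappa>) ^ ((n + k choose 2) - (n choose 2)) * (a * exp \<kappa>) ^ (n + k)"
  proof -
    have "(n + Suc k choose 2) - (n choose 2) = (n + k choose 2) - (n choose 2) + (n + k)"
      using mono by (simp add: choose_two_Suc)
    then show ?thesis by (simp only: power_add mult.assoc)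
  qed
  also have "\<dots> \<le> turan_prod r d a (n + k) * (a * exp \<kappa>) ^ (n + k)"
    using Suc by (intro mult_right_mono) auto
  also have "\<dots> \<le> turan_prod r d a (n + Suc k)"
    using turan_prod_increment[OF assms, of "n + k"] by simp
  finally show ?case .
qed simp

lemma choose_two_add: "(n + k choose 2) = (n choose 2) + (k choose 2) + n * k"
  by (induction k) (auto simp: choose_two_Suc binomial_eq_0)

section \<open>The extremal product on arbitrary vertex sets\<close>

text \<open>For \<open>2 \<le> s \<le> n\<close> each pair lies in some \<open>s\<close>-set, so its
  multiplicity is at most \<open>q\<close>.\<close>

lemma finite_edge_product_sq_graphs:
  assumes "2 \<le> s" "s \<le> n"
  shows "finite (edge_product ` sq_graphs n s q)"
proof -
  have "edge_product G \<le> (\<Prod>e\<in>[{1..n}]\<^bsup>2\<^esup>. q)" if G: "G \<in> sq_graphs n s q" for G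
  proof -
    have "snd G e \<le> q" if e: "e \<in> [{1..n}]\<^bsup>2\<^esup>" for e
    proof -
      have "e \<subseteq> {1..n}" "card e = 2" "finite e" using e by (auto simp: nsets_def)
      then obtain Y where Y: "e \<subseteq> Y" "Y \<subseteq> {1..n}" "card Y = s"
        using exists_subset_between[of e s "{1..n}"] assms by auto
      have "finite Y" using Y(2) finite_subset by blast
      then have "Y \<in> [{1..n}]\<^bsup>s\<^esup>" using Y by (simp add: nsets_def)
      then have "edges_in G Y \<le> q" using G by (simp add: sq_graphs_def)
      moreover have "e \<in> [Y]\<^bsup>2\<^esup>" using Y e by (auto simp: nsets_def)
      then have "snd G e \<le> edges_in G Y"
        unfolding edges_in_def
        by (intro member_le_sum) (auto intro: finite_imp_finite_nsets \<open>finite Y\<close>)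
      ultimately show ?thesis by simp
    qed
    then have "prod (snd G) ([{1..n}]\<^bsup>2\<^esup>) \<le> (\<Prod>e\<in>[{1..n}]\<^bsup>2\<^esup>. q)"
      by (intro prod_mono) auto
    then show ?thesis
      using G by (simp add: sq_graphs_def edge_product_def)
  qed
  then show ?thesis
    by (intro finite_subset[OF _ finite_atMost[of "\<Prod>e\<in>[{1..n}]\<^bsup>2\<^esup>. q"]]) auto
qed

text \<open>Relabelling along a bijection frees the vertex set from being an initial segment, as the
  induction deletes arbitrary vertices.\<close>

lemma prod_le_ex_prod:
  assumes "finite V" "2 \<le> s" "s \<le> card V"
    and w: "\<And>Y. Y \<in> [V]\<^bsup>s\<^esup> \<Longrightarrow> sum w ([Y]\<^bsup>2\<^esup>) \<le> q"
  shows "prod w ([V]\<^bsup>2\<^esup>) \<le> ex_prod (card V) s q"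
proof -
  let ?U = "{1..card V}"
  obtain h where h: "bij_betw h ?U V"
    using assms(1) ex_bij_betw_nat_finite_1 by blast
  define G where "G = (?U, restrict (\<lambda>e. w (h ` e)) ([?U]\<^bsup>2\<^esup>))"
  have "edges_in G X \<le> q" if X: "X \<in> [?U]\<^bsup>s\<^esup>" for X
  proof -
    have bij: "bij_betw h X (h ` X)"
      using h X by (auto simp: bij_betw_def nsets_def intro: inj_on_subset)
    have "edges_in G X = (\<Sum>e\<in>[X]\<^bsup>2\<^esup>. w (h ` e))"
      unfolding edges_in_def G_def using X by (intro sum.cong) (auto simp: nsets_def)
    also have "\<dots> = sum w ([h ` X]\<^bsup>2\<^esup>)"
      by (rule sum.reindex_bij_betw[OF bij_betw_nsets[OF bij]])
    also have "\<dots> \<le> q"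
      using bij_betw_nsets[OF h, of s] X by (intro w) (auto simp: bij_betw_def)
    finally show ?thesis .
  qed
  then have "G \<in> sq_graphs (card V) s q"
    by (auto simp: sq_graphs_def multigraph_def G_def)
  then have "edge_product G \<le> ex_prod (card V) s q"
    unfolding ex_prod_def using finite_edge_product_sq_graphs[OF assms(2,3)] by (intro Max_ge) auto
  moreover have "edge_product G = prod w ([V]\<^bsup>2\<^esup>)"
    unfolding G_def edge_product_restrict by (rule prod.reindex_bij_betw[OF bij_betw_nsets[OF h]])
  ultimately show ?thesis by simp
qed

text \<open>Restricting the colouring to an \<open>s\<close>-set gives a competitor for
  \<open>turan_sum r d a s\<close>.\<close>

lemma turan_graphs_subset_sq_graphs:
  assumes "r > 0"
  shows "turan_graphs r d a n \<subseteq> sq_graphs n s (turan_sum r d a s)"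
proof
  fix G assume "G \<in> turan_graphs r d a n"
  then obtain c where c: "c \<in> {1..n} \<rightarrow> {..<r}"
    and G: "G = ({1..n}, restrict (turan_mult d a c) ([{1..n}]\<^bsup>2\<^esup>))"
    using turan_graphs_iff[OF assms] by blast
  have "edges_in G X \<le> turan_sum r d a s" if X: "X \<in> [{1..n}]\<^bsup>s\<^esup>" for X
  proof -
    have "edges_in G X = sum (turan_mult d a c) ([X]\<^bsup>2\<^esup>)"
      unfolding edges_in_def G using X by (intro sum.cong) (auto simp: nsets_def)
    also have "\<dots> \<le> turan_sum r d a (card X)"
      using X c by (intro turan_sum_upper assms) (auto simp: nsets_def)
    finally show ?thesis using X by (simp add: nsets_def)
  qed
  then show "G \<in> sq_graphs n s (turan_sum r d a s)"
    by (auto simp: sq_graphs_def multigraph_def G)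
qed

section \<open>Deleting dense sets\<close>

text \<open>The deleted pairs are those meeting \<open>X\<close>. If \<open>X\<close> spans
  \<open>x\<close> edges, each outside vertex sends at most \<open>q' - x\<close> edges to it, so
  these pairs carry at most \<open>x + N * (q' - x)\<close> edges in total.
  \<open>prod_le_exp_excess\<close> turns this into a bound on their product.\<close>

lemma prod_remove_dense_set:
  fixes w :: "'a set \<Rightarrow> nat" and a q q' :: nat
  assumes "finite V" "X \<subseteq> V" "card X = s" "card (V - X) = N" "N > 0" "a > 0"
    and dense: "sum w ([X]\<^bsup>2\<^esup>) \<ge> q + 1"
    and sparse: "\<And>Y. Y \<in> [V]\<^bsup>(s + 1)\<^esup> \<Longrightarrow> sum w ([Y]\<^bsup>2\<^esup>) \<le> q'"
  shows "real (prod w ([V]\<^bsup>2\<^esup>)) \<le> real (prod w ([V - X]\<^bsup>2\<^esup>)) *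
    (real a ^ ((N + s choose 2) - (N choose 2)) *
     exp ((N * (real q' - q - 1 - a * s) + q + 1 - a * real (s choose 2)) / a))"
proof -
  define E where "E = [V]\<^bsup>2\<^esup> - [V - X]\<^bsup>2\<^esup>"
  define x where "x = sum w ([X]\<^bsup>2\<^esup>)"
  define t where "t = (\<Sum>v\<in>V - X. \<Sum>y\<in>X. w {y, v})"
  have fin: "finite X" "finite (V - X)" "finite ([V]\<^bsup>2\<^esup>)"
    using assms(1,2) finite_subset by (auto intro: finite_imp_finite_nsets)
  have sub: "[V - X]\<^bsup>2\<^esup> \<subseteq> [V]\<^bsup>2\<^esup>" by (auto simp: nsets_def)
  have V: "V = (V - X) \<union> X" using assms(2) by auto
  have cV: "card V = N + s"
    using V fin assms(3,4) card_Un_disjoint[of "V - X" X] by auto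
  have cE: "card E = (N + s choose 2) - (N choose 2)"
    unfolding E_def using sub fin cV assms(4) by (simp add: card_Diff_subset finite_subset)
  have sumE: "sum w E = x + t"
  proof -
    have "sum w ([V]\<^bsup>2\<^esup>) = x + sum w ([V - X]\<^bsup>2\<^esup>) + t"
      using sum_nsets_2_Un[OF fin(1,2), of w] V unfolding x_def t_def by (metis Diff_disjoint)
    moreover have "sum w ([V]\<^bsup>2\<^esup>) = sum w E + sum w ([V - X]\<^bsup>2\<^esup>)"
      unfolding E_def by (rule sum.subset_diff[OF sub fin(3)])
    ultimately show ?thesis by simp
  qed
  have "x + (\<Sum>y\<in>X. w {y, v}) \<le> q'" if v: "v \<in> V - X" for v
  proof -
    have "insert v X \<in> [V]\<^bsup>(s + 1)\<^esup>"
      using v fin assms(2,3) by (auto simp: nsets_def)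
    then show ?thesis
      using sparse sum_nsets_2_insert[of X v w] v fin(1) by (fastforce simp: x_def)
  qed
  then have "(\<Sum>v\<in>V - X. x + (\<Sum>y\<in>X. w {y, v})) \<le> N * q'"
    using sum_bounded_above[of "V - X" "\<lambda>v. x + (\<Sum>y\<in>X. w {y, v})" q'] assms(4) by simp
  then have "N * x + t \<le> N * q'"
    using assms(4) by (simp add: sum.distrib t_def)
  then have "real (N * x + t) \<le> real (N * q')" by (simp only: of_nat_le_iff)
  \<comment> \<open>In the total, \<open>x\<close> occurs with coefficient \<open>1 - N\<close>. As
    \<open>N > 0\<close>, the bound is weakest at the least possible value
    \<open>x = q + 1\<close>.\<close>
  moreover have "(real N - 1) * (q + 1) \<le> (real N - 1) * x"
  proof (rule mult_left_mono)
    have "real (q + 1) \<le> real x" using dense unfolding of_nat_le_iff x_def .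
    then show "real (q + 1) \<le> real x" .
  qed (use assms(5) in simp)
  ultimately have "real (x + t) \<le> N * (real q' - q - 1) + q + 1"
    by (simp add: algebra_simps)
  moreover have "real (card E) = N * s + real (s choose 2)"
    by (simp add: cE choose_two_add)
  ultimately have excess: "real (x + t) - real a * card E
      \<le> N * (real q' - q - 1 - a * s) + q + 1 - a * real (s choose 2)"
    by (simp add: algebra_simps)
  have "real (prod w ([V]\<^bsup>2\<^esup>)) = real (prod w ([V - X]\<^bsup>2\<^esup>)) * (\<Prod>e\<in>E. real (w e))"
    using prod.subset_diff[OF sub fin(3), of w] by (simp add: E_def mult.commute)
  also have "\<dots> \<le> real (prod w ([V - X]\<^bsup>2\<^esup>)) *
      (real a ^ card E * exp (((\<Sum>e\<in>E. real (w e)) - real a * card E) / a))"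
    using assms(6) by (intro mult_left_mono prod_le_exp_excess) (auto intro: prod_nonneg)
  also have "(\<Sum>e\<in>E. real (w e)) = real (x + t)" by (simp flip: sumE)
  also have "real (prod w ([V - X]\<^bsup>2\<^esup>)) * (real a ^ card E * exp ((real (x + t) - real a * card E) / a))
    \<le> real (prod w ([V - X]\<^bsup>2\<^esup>)) * (real a ^ card E *
      exp ((N * (real q' - q - 1 - a * s) + q + 1 - a * real (s choose 2)) / a))"
    using excess by (intro mult_left_mono) (auto intro!: divide_right_mono prod_nonneg)
  finally show ?thesis unfolding cE .
qed

text \<open>Strong induction on the order. The factor \<open>exp (max 0 (K - card V) / a)\<close> is
  a slack that vanishes from order \<open>K\<close> on and covers every graph of order below
  \<open>N\<^sub>1 + s\<close>. Deleting \<open>s\<close> vertices raises its numerator by at most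
  \<open>s\<close>. \<open>C\<close> collects the terms independent of the order, and
  \<open>N\<^sub>1\<close> is so large that the gain \<open>N / (2 * D)\<close> of a deletion pays
  for \<open>C + s\<close>. None of these constants depends on \<open>a\<close>.\<close>

lemma sparse_prod_le:
  fixes r d s n\<^sub>0 D C N\<^sub>1 a K :: nat and w :: "'a set \<Rightarrow> nat"
  assumes r: "r > 0" and d: "d > 0" and s: "s \<ge> 2"
    and D: "D = 1 + (r - 1) * (d + 1)"
    and C: "C = (s choose 2) * (1 + d + 2 * d^2) + 1"
    and N1: "N\<^sub>1 = max n\<^sub>0 (2 * D * (C + s) + 1)"
    and K: "K = N\<^sub>1 + s + (N\<^sub>1 + s choose 2) * (1 + d + 2 * d^2)"
    and a: "a \<ge> 2 * d" "a \<ge> 4 * d^2 * s * D"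
    and ex: "\<And>n. n \<ge> n\<^sub>0 \<Longrightarrow> ex_prod n s (turan_sum r d a s) = turan_prod r d a n"
    and V: "finite V" "card V \<ge> N\<^sub>1"
    and sparse: "\<And>Y. Y \<in> [V]\<^bsup>(s + 1)\<^esup> \<Longrightarrow> sum w ([Y]\<^bsup>2\<^esup>) \<le> turan_sum r d a (s + 1)"
  shows "real (prod w ([V]\<^bsup>2\<^esup>)) \<le> turan_prod r d a (card V) * exp (max 0 (real K - card V) / a)"
proof -
  define \<rho> :: real where "\<rho> = 1 - (d + 1) / D"
  define \<kappa> :: real where "\<kappa> = (1 - (d + 1) / D) / a - 2 * (real d)^2 / (real a)^2"
  have D0: "real D \<ge> 1" using D by simp
  have a1: "real a \<ge> 1" using a(1) d by simp
  \<comment> \<open>\<rho> can be negative: \<open>r = 1\<close> gives \<open>D = 1\<close> and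
    equality here.\<close>
  have \<rho>: "\<rho> \<ge> - real d"
  proof -
    have "(d + 1) / real D \<le> (d + 1) / 1" using D0 by (intro divide_left_mono) auto
    then show ?thesis by (simp add: \<rho>_def)
  qed
  have \<kappa>a: "\<kappa> * a = \<rho> - 2 * (real d)^2 / a"
    using a1 unfolding \<kappa>_def \<rho>_def[symmetric] by (simp add: left_diff_distrib power2_eq_square)
  have d2a: "2 * (real d)^2 / a \<le> 2 * (real d)^2"
    using a1 by (simp add: divide_le_eq mult_le_cancel_left1)
  have N1s: "N\<^sub>1 \<ge> s + 1" and N1n: "N\<^sub>1 \<ge> n\<^sub>0" and N1C: "N\<^sub>1 \<ge> 2 * D * (C + s)"
  proof -
    have "1 * s \<le> (2 * D) * (C + s)" using D by (intro mult_mono) auto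
    then show "N\<^sub>1 \<ge> s + 1" using N1 by simp
  qed (use N1 in auto)
  show ?thesis using V sparse
  proof (induction "card V" arbitrary: V rule: less_induct)
    case less
    define n where "n = card V"
    have n: "n \<ge> N\<^sub>1" using less by (simp add: n_def)
    \<comment> \<open>The cut at \<open>N\<^sub>1 + s\<close> ensures that at least
      \<open>N\<^sub>1\<close> vertices remain after an \<open>s\<close>-set is deleted, so the
      induction hypothesis applies.\<close>
    consider (sparse) "\<And>Y. Y \<in> [V]\<^bsup>s\<^esup> \<Longrightarrow> sum w ([Y]\<^bsup>2\<^esup>) \<le> turan_sum r d a s"
      | (small) "n < N\<^sub>1 + s"
      | (dense) X where "n \<ge> N\<^sub>1 + s" "X \<in> [V]\<^bsup>s\<^esup>" "sum w ([X]\<^bsup>2\<^esup>) \<ge> turan_sum r d a s + 1"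
      by (metis Suc_eq_plus1 not_less not_less_eq_eq)
    then show ?case
    proof cases
      case sparse
      have "prod w ([V]\<^bsup>2\<^esup>) \<le> ex_prod (card V) s (turan_sum r d a s)"
        using less n n_def N1s s by (intro prod_le_ex_prod sparse) auto
      also have "\<dots> = turan_prod r d a (card V)" using n N1n n_def by (intro ex) auto
      finally have "real (prod w ([V]\<^bsup>2\<^esup>)) \<le> real (turan_prod r d a (card V)) * 1"
        by (simp only: of_nat_le_iff mult_1_right)
      also have "\<dots> \<le> turan_prod r d a (card V) * exp (max 0 (real K - card V) / a)"
        by (intro mult_left_mono) auto
      finally show ?thesis .
    next
      case small
      define M where "M = (n choose 2)"
      have M: "card ([V]\<^bsup>2\<^esup>) = M" by (simp add: M_def n_def)
      \<comment> \<open>Since \<open>turan_sum\<close> allows average multiplicity at most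
        \<open>a + 1\<close> on \<open>(s + 1)\<close>-sets, averaging gives the same for
        \<open>V\<close>. The excess over \<open>a\<close> is thus at most \<open>M\<close>,
        independently of \<open>a\<close>.\<close>
      have e: "sum w ([V]\<^bsup>2\<^esup>) \<le> (a + 1) * M"
        unfolding M_def n_def
      proof (rule sum_nsets_2_le_density)
        fix Y assume "Y \<in> [V]\<^bsup>(s + 1)\<^esup>"
        then show "sum w ([Y]\<^bsup>2\<^esup>) \<le> (a + 1) * (s + 1 choose 2)"
          using less.prems(3) turan_sum_le[OF r] order_trans by blast
      qed (use less n n_def N1s s in auto)
      then have "real (sum w ([V]\<^bsup>2\<^esup>)) \<le> real ((a + 1) * M)" by (simp only: of_nat_le_iff)
      then have e': "(\<Sum>e\<in>[V]\<^bsup>2\<^esup>. real (w e)) - real a * M \<le> M" by (simp add: algebra_simps)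
      have "M \<le> (N\<^sub>1 + s choose 2)"
        unfolding M_def using small by (intro binomial_right_mono) auto
      then have "M * (1 + d + 2 * d^2) \<le> (N\<^sub>1 + s choose 2) * (1 + d + 2 * d^2)"
        by (rule mult_right_mono) simp
      then have "M * (1 + d + 2 * d^2) + n \<le> K" using small K by simp
      then have "real (M * (1 + d + 2 * d^2) + n) \<le> real K" by (simp only: of_nat_le_iff)
      then have KM: "M * (1 + real d + 2 * (real d)^2) \<le> real K - n"
        by (simp add: algebra_simps)
      have "real M * (- (real d + 2 * (real d)^2)) \<le> M * (\<kappa> * a)"
        unfolding \<kappa>a using \<rho> d2a by (intro mult_left_mono) auto
      then have "real M \<le> M * \<kappa> * a + max 0 (real K - n)"
        using KM by (simp add: algebra_simps)
      then have expo: "M / real a \<le> M * \<kappa> + max 0 (real K - n) / a"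
        using a1 by (simp add: field_simps)
      have "real (prod w ([V]\<^bsup>2\<^esup>)) = (\<Prod>e\<in>[V]\<^bsup>2\<^esup>. real (w e))" by simp
      also have "\<dots> \<le> real a ^ M * exp (((\<Sum>e\<in>[V]\<^bsup>2\<^esup>. real (w e)) - real a * M) / a)"
        using a1 prod_le_exp_excess[of "real a" "[V]\<^bsup>2\<^esup>" "\<lambda>e. real (w e)"] M by simp
      also have "\<dots> \<le> real a ^ M * exp (M / real a)"
        using e' a1 by (intro mult_left_mono) (auto intro!: divide_right_mono)
      also have "\<dots> \<le> real a ^ M * exp (M * \<kappa> + max 0 (real K - n) / a)"
        using expo by (intro mult_left_mono) auto
      also have "\<dots> = 1 * (real a * exp \<kappa>) ^ M * exp (max 0 (real K - n) / a)"
        by (simp add: power_mult_distrib exp_add exp_of_nat_mult)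
      \<comment> \<open>The comparison graph is grown from the empty graph, whose product is a
        positive integer and hence at least 1.\<close>
      also have "\<dots> \<le> turan_prod r d a 0 * (real a * exp \<kappa>) ^ M * exp (max 0 (real K - n) / a)"
      proof -
        have "turan_prod r d a 0 > 0" using turan_prod_pos[OF r, of d a 0] a(1) d by simp
        then show ?thesis by (intro mult_right_mono) auto
      qed
      also have "\<dots> \<le> turan_prod r d a n * exp (max 0 (real K - n) / a)"
        using turan_prod_growth[OF r d a(1) D \<kappa>_def, of 0 n]
        by (intro mult_right_mono) (auto simp: M_def binomial_eq_0)
      finally show ?thesis by (simp only: n_def)
    next
      case (dense X)
      define N where "N = n - s"
      define q where "q = turan_sum r d a s"
      define q' where "q' = turan_sum r d a (s + 1)"
      define S where "S = real (s choose 2)"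
      define m where "m = (N + s choose 2) - (N choose 2)"
      have N: "N \<ge> N\<^sub>1" "n = N + s" "N < n" "N > 0" using dense(1) N1s s by (auto simp: N_def)
      have X: "X \<subseteq> V" "card X = s" "finite X" using dense(2) by (auto simp: nsets_def)
      have cVX: "card (V - X) = N" using X by (simp add: card_Diff_subset N_def n_def)
      have m: "real m = N * s + S" by (simp add: m_def S_def choose_two_add)
      have IH: "real (prod w ([V - X]\<^bsup>2\<^esup>)) \<le> turan_prod r d a N * exp (max 0 (real K - N) / a)"
      proof -
        have "sum w ([Y]\<^bsup>2\<^esup>) \<le> turan_sum r d a (s + 1)" if "Y \<in> [V - X]\<^bsup>(s + 1)\<^esup>" for Y
          using that by (intro less.prems(3)) (auto simp: nsets_def)
        then show ?thesis using less.hyps[of "V - X"] less.prems(1) N cVX by (simp add: n_def)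
      qed
      have incr: "real q' - q - 1 - a * s \<le> s * \<rho> - 1 / D"
        unfolding q_def q'_def \<rho>_def using turan_sum_increment[OF r _ D, of a s] a(1)
        by (simp add: add.commute)
      have qS: "real q - a * S \<le> S"
      proof -
        have "real q \<le> real ((a + 1) * (s choose 2))"
          unfolding q_def of_nat_le_iff by (rule turan_sum_le[OF r])
        then show ?thesis by (simp add: S_def algebra_simps)
      qed
      \<comment> \<open>All exponents are compared after multiplication by \<open>a\<close>. The
        terms \<open>N * s * \<rho>\<close> cancel. Of the gain \<open>N / D\<close>, half pays for
        the second-order error, by \<open>a \<ge> 4 * d^2 * s * D\<close>, and the other half
        exceeds \<open>C + s\<close>.\<close>
      have loss: "N * (real q' - q - 1 - a * s) + q + 1 - a * S + max 0 (real K - N)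
        \<le> m * (\<kappa> * a) + max 0 (real K - n)"
      proof -
        define \<epsilon> where "\<epsilon> = 2 * (real d)^2 / a"
        have \<epsilon>: "s * \<epsilon> \<le> 1 / (2 * D)"
        proof -
          have "real (4 * d^2 * s * D) \<le> real a" using a(2) by (simp only: of_nat_le_iff)
          then show ?thesis using a1 D0 by (simp add: \<epsilon>_def field_simps)
        qed
        have "N * (real q' - q - 1 - a * s) \<le> N * (s * \<rho> - 1 / D)"
          using incr by (intro mult_left_mono) auto
        moreover have "N * (s * \<epsilon>) \<le> N * (1 / (2 * D))"
          using \<epsilon> by (intro mult_left_mono) auto
        moreover have "S * (- (real d + 2 * (real d)^2)) \<le> S * (\<kappa> * a)"
          unfolding \<kappa>a using \<rho> d2a by (intro mult_left_mono) (auto simp: S_def)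
        moreover have "m * (\<kappa> * a) = N * (s * \<rho>) - N * (s * \<epsilon>) + S * (\<kappa> * a)"
          unfolding m \<kappa>a \<epsilon>_def[symmetric] by (simp add: algebra_simps)
        \<comment> \<open>The three parts of \<open>C\<close>: \<open>S\<close> from
          \<open>qS\<close>, the lower bound for \<open>S * (\<kappa> * a)\<close>, and the 1 from
          \<open>q + 1\<close>.\<close>
        moreover have "real C = S - S * (- (real d + 2 * (real d)^2)) + 1"
          unfolding C S_def by (simp add: algebra_simps)
        moreover have "real C + real s \<le> N * (1 / (2 * real D))"
        proof -
          have "real (2 * D * (C + s)) \<le> real N" using N(1) N1C unfolding of_nat_le_iff by simp
          then show ?thesis using D0 by (simp add: field_simps)
        qed
        moreover have "N * (s * \<rho> - 1 / D) = N * (s * \<rho>) - 2 * (N * (1 / (2 * real D)))"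
          using D0 by (simp add: field_simps)
        moreover have "max 0 (real K - N) \<le> max 0 (real K - n) + s"
          using N(2) by simp
        ultimately show ?thesis using qS by linarith
      qed
      have "real (prod w ([V]\<^bsup>2\<^esup>)) \<le> real (prod w ([V - X]\<^bsup>2\<^esup>)) *
        (real a ^ m * exp ((N * (real q' - q - 1 - a * s) + q + 1 - a * S) / a))"
        unfolding m_def S_def
        by (rule prod_remove_dense_set)
          (use X cVX N a1 less.prems dense in \<open>auto simp: q_def q'_def\<close>)
      also have "\<dots> \<le> (turan_prod r d a N * exp (max 0 (real K - N) / a)) *
        (real a ^ m * exp ((N * (real q' - q - 1 - a * s) + q + 1 - a * S) / a))"
        using IH by (intro mult_right_mono) auto
      also have "\<dots> = turan_prod r d a N * real a ^ m *
        exp ((N * (real q' - q - 1 - a * s) + q + 1 - a * S + max 0 (real K - N)) / a)"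
        by (simp add: add_divide_distrib exp_add)
      also have "\<dots> \<le> turan_prod r d a N * real a ^ m *
        exp ((m * (\<kappa> * a) + max 0 (real K - n)) / a)"
        using loss by (intro mult_left_mono) (auto intro!: divide_right_mono)
      also have "\<dots> = turan_prod r d a N * (real a * exp \<kappa>) ^ m * exp (max 0 (real K - n) / a)"
        using a1 by (simp add: add_divide_distrib exp_add power_mult_distrib exp_of_nat_mult)
      also have "\<dots> \<le> turan_prod r d a n * exp (max 0 (real K - n) / a)"
        using turan_prod_growth[OF r d a(1) D \<kappa>_def, of N s]
        by (intro mult_right_mono) (auto simp: m_def N(2))
      finally show ?thesis by (simp only: n_def)
    qed
  qed
qed

section \<open>Choice of thresholds and conclusion\<close>

theorem theorem3p11:
  fixes r d s a\<^sub>0 n\<^sub>0 :: nat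
  assumes "r > 0" and "d > 0"
    and "s \<ge> (r - 1) * (d + 1) + 2"
    and "\<forall>a\<ge>a\<^sub>0. \<forall>n\<ge>n\<^sub>0. ex_prod n s (turan_sum r d a s) = turan_prod r d a n"
  shows "\<exists>a\<^sub>1\<ge>a\<^sub>0. \<exists>n\<^sub>1\<ge>n\<^sub>0. \<forall>a\<ge>a\<^sub>1. \<forall>n\<ge>n\<^sub>1.
           ex_prod n (s + 1) (turan_sum r d a (s + 1)) = turan_prod r d a n"
proof -
  define D where "D = 1 + (r - 1) * (d + 1)"
  define C where "C = (s choose 2) * (1 + d + 2 * d^2) + 1"
  define N\<^sub>1 where "N\<^sub>1 = max n\<^sub>0 (2 * D * (C + s) + 1)"
  define K where "K = N\<^sub>1 + s + (N\<^sub>1 + s choose 2) * (1 + d + 2 * d^2)"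
  \<comment> \<open>The summands serve, in order, the hypothesis on \<open>s\<close>, the logarithm
    estimates, and the second-order error in the deletion step.\<close>
  define a\<^sub>1 where "a\<^sub>1 = a\<^sub>0 + 2 * d + 4 * d^2 * s * D"
  have s: "s \<ge> 2" using assms(3) by simp
  have K: "K \<ge> N\<^sub>1" "K \<ge> n\<^sub>0" "K \<ge> s + 1" by (auto simp: K_def N\<^sub>1_def)
  have "ex_prod n (s + 1) (turan_sum r d a (s + 1)) = turan_prod r d a n"
    if a: "a \<ge> a\<^sub>1" and n: "n \<ge> K" for a n
    unfolding ex_prod_def
  proof (rule Max_eqI)
    show "finite (edge_product ` sq_graphs n (s + 1) (turan_sum r d a (s + 1)))"
      using s n K(3) by (intro finite_edge_product_sq_graphs) auto
  next
    obtain c where c: "c \<in> {1..n} \<rightarrow> {..<r}"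
      "turan_prod r d a n = prod (turan_mult d a c) ([{1..n}]\<^bsup>2\<^esup>)"
      using turan_prod_attained[OF assms(1)] by metis
    then have "turan_prod r d a n \<in> edge_product ` turan_graphs r d a n"
      unfolding edge_product_turan_graphs[OF assms(1)] by blast
    then show "turan_prod r d a n \<in> edge_product ` sq_graphs n (s + 1) (turan_sum r d a (s + 1))"
      using turan_graphs_subset_sq_graphs[OF assms(1)] by blast
  next
    fix y assume "y \<in> edge_product ` sq_graphs n (s + 1) (turan_sum r d a (s + 1))"
    then obtain G where G: "G \<in> sq_graphs n (s + 1) (turan_sum r d a (s + 1))"
      and y: "y = edge_product G" by blast
    have "real (prod (snd G) ([{1..n}]\<^bsup>2\<^esup>))
      \<le> turan_prod r d a (card {1..n}) * exp (max 0 (real K - card {1..n}) / a)"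
    proof (rule sparse_prod_le[OF assms(1,2) s D_def C_def N\<^sub>1_def K_def])
      show "ex_prod k s (turan_sum r d a s) = turan_prod r d a k" if "k \<ge> n\<^sub>0" for k
        using assms(4) that a by (simp add: a\<^sub>1_def)
      show "sum (snd G) ([Y]\<^bsup>2\<^esup>) \<le> turan_sum r d a (s + 1)" if "Y \<in> [{1..n}]\<^bsup>(s + 1)\<^esup>" for Y
        using G that by (auto simp: sq_graphs_def edges_in_def)
    qed (use a n K in \<open>auto simp: a\<^sub>1_def\<close>)
    \<comment> \<open>For \<open>n \<ge> K\<close> the slack factor is \<open>exp 0\<close>, so the
      bound is exact.\<close>
    also have "\<dots> = turan_prod r d a n" using n by simp
    finally show "y \<le> turan_prod r d a n"
      using G by (simp only: of_nat_le_iff) (simp add: y edge_product_def sq_graphs_def)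
  qed
  then show ?thesis
    using K(2) by (intro exI[of _ a\<^sub>1] conjI exI[of _ K]) (auto simp: a\<^sub>1_def)
qed

end
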